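(* Let $G$ be a finite abelian group, let $k\geq 2$, and let $B\subseteq G$ be a $k$-separable subset with $r=\kappa_k(B)-|B|$ and $\langle B-B\rangle=G$. Suppose $B$ has a $k$-atom $X$ that is not a coset. Then $$\alpha_k(B)=|X|\leq \lceil k/|H|\rceil\cdot|H|-|H|+r+|H|\,\alpha_2(\overline X)\leq k-1+r+|H|\,\alpha_2(\overline X),$$ where $H=\mathsf H(X)$ and $\overline X\subseteq G/H$ denotes the image of $X$ modulo $H$.
   Context: For $X\subseteq G$, $\mathsf H(X)=\{x\in G: x+X=X\}$ is the stabilizer of $X$; "coset" means a coset of a subgroup of $G$. $B-B=\{b-b':b,b'\in B\}$ and $\langle\cdot\rangle$ is the generated subgroup. For an abelian group $G$, finite nonempty $B\subseteq G$ and integer $k\ge1$, $B$ is $k$-separable if there is a finite $X\subseteq G$ with $|X|\geq k$ and $|G\setminus(X+B)|\geq k$; then $\kappa_k(B)=\min\{|X+B|-|X|: X\subseteq G \text{ finite},\ |X|\geq k,\ |G\setminus (X+B)|\geq k\}$. A set attaining this minimum (with $|X|\ge k$, $|G\setminus(X+B)|\ge k$) is a $k$-fragment of $B$; a $k$-fragment of minimal cardinality is a $k$-atom, and $\alpha_k(B)$ denotes the cardinality of a $k$-atom. The quantity $\alpha_2(\overline X)$ is this notion (with $k=2$) for the subset $\overline X$ of the group $G/H$ (the statement implicitly includes that $\overline X$ is $2$-separable in $G/H$). *)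

theory Defs
  imports Complex_Main "HOL-Algebra.Generated_Groups" "HOL-Algebra.Group_Action"
begin

text \<open>
  Groups are written multiplicatively as in HOL-Algebra, so the sumset \<open>X + B\<close> is
  \<open>X <#>\<^bsub>G\<^esub> B\<close> and the difference set \<open>B - B\<close> is \<open>B <#>\<^bsub>G\<^esub> (set_inv\<^bsub>G\<^esub> B)\<close>.
  The notions below are meant for a finite nonempty subset \<open>B\<close> of the carrier of an abelian
  group \<open>G\<close> and \<open>k \<ge> 1\<close>. They take the group as an argument because they are used both in
  a group and in its quotients.
\<close>

text \<open>
  The sets \<open>X\<close> over which \<open>\<kappa>\<^sub>k(B)\<close> is minimised. The infinite case is separate because
  \<^const>\<open>card\<close> is 0 on infinite sets.
\<close>

definition sep_witness :: "('a, 'b) monoid_scheme \<Rightarrow> nat \<Rightarrow> 'a set \<Rightarrow> 'a set \<Rightarrow> bool" where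
  "sep_witness G k B X \<longleftrightarrow>
     X \<subseteq> carrier G \<and> finite X \<and> k \<le> card X \<and>
     (infinite (carrier G - (X <#>\<^bsub>G\<^esub> B)) \<or> k \<le> card (carrier G - (X <#>\<^bsub>G\<^esub> B)))"

definition separable :: "('a, 'b) monoid_scheme \<Rightarrow> nat \<Rightarrow> 'a set \<Rightarrow> bool" where
  "separable G k B \<longleftrightarrow> (\<exists>X. sep_witness G k B X)"

text \<open>
  For nonempty finite \<open>B\<close> the differences are nonnegative, so the minimum exists as soon as
  \<open>B\<close> is \<open>k\<close>-separable.
\<close>

definition kappa :: "('a, 'b) monoid_scheme \<Rightarrow> nat \<Rightarrow> 'a set \<Rightarrow> int" where
  "kappa G k B =
     (LEAST d. \<exists>X. sep_witness G k B X \<and> d = int (card (X <#>\<^bsub>G\<^esub> B)) - int (card X))"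

definition fragment :: "('a, 'b) monoid_scheme \<Rightarrow> nat \<Rightarrow> 'a set \<Rightarrow> 'a set \<Rightarrow> bool" where
  "fragment G k B X \<longleftrightarrow>
     sep_witness G k B X \<and> int (card (X <#>\<^bsub>G\<^esub> B)) - int (card X) = kappa G k B"

definition atom :: "('a, 'b) monoid_scheme \<Rightarrow> nat \<Rightarrow> 'a set \<Rightarrow> 'a set \<Rightarrow> bool" where
  "atom G k B X \<longleftrightarrow> fragment G k B X \<and> (\<forall>Y. fragment G k B Y \<longrightarrow> card X \<le> card Y)"

definition alpha :: "('a, 'b) monoid_scheme \<Rightarrow> nat \<Rightarrow> 'a set \<Rightarrow> nat" where
  "alpha G k B = (THE n. \<exists>X. atom G k B X \<and> n = card X)"

definition set_stabilizer :: "('a, 'b) monoid_scheme \<Rightarrow> 'a set \<Rightarrow> 'a set" where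
  "set_stabilizer G X = stabilizer G (l_coset G) X"

definition is_coset :: "('a, 'b) monoid_scheme \<Rightarrow> 'a set \<Rightarrow> bool" where
  "is_coset G X \<longleftrightarrow> (\<exists>K. subgroup K G \<and> X \<in> rcosets\<^bsub>G\<^esub> K)"

definition coset_image :: "('a, 'b) monoid_scheme \<Rightarrow> 'a set \<Rightarrow> 'a set \<Rightarrow> 'a set set" where
  "coset_image G H X = (\<lambda>x. H #>\<^bsub>G\<^esub> x) ` X"

end

theory Submission
  imports Defs
begin

text \<open>
  A submodularity argument shows that two distinct \<open>k\<close>-atoms meet in fewer than \<open>k\<close> points; in a
  finite abelian group the usual size restriction is automatic, since \<open>-(G - (X + B))\<close> is again a
  \<open>k\<close>-fragment. Apply this to \<open>X\<close> and \<open>g + X\<close> with \<open>g \<notin> H\<close>: the intersection is \<open>H\<close>-periodic, so it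
  has at most \<open>(\<lceil>k/|H|\<rceil> - 1)|H|\<close> elements. If \<open>k \<le> |H|\<close> it is empty, which makes \<open>X\<close> a coset.
  Otherwise the image of \<open>B\<close> witnesses that \<open>Xbar\<close> is \<open>2\<close>-separable, whence
  \<open>|H| \<kappa>\<^sub>2(Xbar) \<le> |X| + r\<close>. A \<open>2\<close>-atom \<open>A\<close> of \<open>Xbar\<close> contains two distinct cosets, so
  the preimage of \<open>A + Xbar\<close> contains two distinct translates of \<open>X\<close> and has at least
  \<open>2|X| - (\<lceil>k/|H|\<rceil> - 1)|H|\<close> elements; comparing with \<open>|H|(\<kappa>\<^sub>2(Xbar) + |A|)\<close> gives the bound.
\<close>

section \<open>Fragments and atoms\<close>

text \<open>The integers are not well-ordered, so the \<open>LEAST\<close> in \<open>kappa\<close>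
  is known to be a minimum only once the set of candidate values is finite and nonempty. Here it is
  the image of a set of subsets of a finite carrier.\<close>

lemma finite_kappa_values:
  assumes "finite (carrier G)"
  shows "finite {d. \<exists>X. sep_witness G k B X \<and> d = int (card (X <#>\<^bsub>G\<^esub> B)) - int (card X)}"
proof -
  have "{d. \<exists>X. sep_witness G k B X \<and> d = int (card (X <#>\<^bsub>G\<^esub> B)) - int (card X)}
      \<subseteq> (\<lambda>X. int (card (X <#>\<^bsub>G\<^esub> B)) - int (card X)) ` Pow (carrier G)"
    by (auto simp: sep_witness_def)
  then show ?thesis
    using assms by (meson finite_Pow_iff finite_imageI finite_subset)
qed

lemma kappa_le:
  assumes "finite (carrier G)" and "sep_witness G k B X"
  shows "kappa G k B \<le> int (card (X <#>\<^bsub>G\<^esub> B)) - int (card X)"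
proof -
  let ?P = "\<lambda>d. \<exists>X. sep_witness G k B X \<and> d = int (card (X <#>\<^bsub>G\<^esub> B)) - int (card X)"
  have "kappa G k B = Min {d. ?P d}"
    unfolding kappa_def using Least_Min[of ?P] finite_kappa_values[OF assms(1)] assms(2) by blast
  then show ?thesis
    using Min_le[OF finite_kappa_values[OF assms(1)], of _ k B] assms(2) by auto
qed

lemma fragment_exists:
  assumes "finite (carrier G)" and "separable G k B"
  shows "\<exists>X. fragment G k B X"
proof -
  let ?P = "\<lambda>d. \<exists>X. sep_witness G k B X \<and> d = int (card (X <#>\<^bsub>G\<^esub> B)) - int (card X)"
  have ne: "{d. ?P d} \<noteq> {}"
    using assms(2) by (auto simp: separable_def)
  have "kappa G k B = Min {d. ?P d}"
    unfolding kappa_def using Least_Min[of ?P] finite_kappa_values[OF assms(1)] ne by blast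
  then have "?P (kappa G k B)"
    using Min_in[OF finite_kappa_values[OF assms(1)] ne] by simp
  then show ?thesis
    by (auto simp: fragment_def)
qed

lemma atom_exists:
  assumes "finite (carrier G)" and "separable G k B"
  shows "\<exists>X. atom G k B X"
proof -
  obtain X where "fragment G k B X"
    using fragment_exists[OF assms] by blast
  then show ?thesis
    using ex_has_least_nat[of "fragment G k B" X card] by (auto simp: atom_def)
qed

text \<open>Any two atoms bound each other's size, so the description in \<open>alpha\<close> is
  unique.\<close>

lemma alpha_eq:
  assumes "atom G k B X"
  shows "alpha G k B = card X"
  unfolding alpha_def
proof (rule the_equality)
  show "n = card X" if "\<exists>Y. atom G k B Y \<and> n = card Y" for n
    using that assms by (auto simp: atom_def intro: antisym)
qed (use assms in blast)

section \<open>Atoms of a finite abelian group\<close>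

context comm_group
begin

text \<open>Finiteness removes the infinite case, and the additive form of the complement condition
  avoids truncated subtraction.\<close>

lemma sep_witness_iff:
  assumes "finite (carrier G)" "B \<subseteq> carrier G"
  shows "sep_witness G k B X \<longleftrightarrow>
    X \<subseteq> carrier G \<and> k \<le> card X \<and> card (X <#> B) + k \<le> card (carrier G)"
proof (cases "X \<subseteq> carrier G")
  case True
  then have sub: "X <#> B \<subseteq> carrier G"
    using assms(2) by (rule set_mult_closed)
  then have "card (carrier G - (X <#> B)) = card (carrier G) - card (X <#> B)"
    using assms(1) by (meson card_Diff_subset finite_subset)
  moreover have "card (X <#> B) \<le> card (carrier G)"
    using sub assms(1) by (rule card_mono[rotated])
  ultimately show ?thesis
    using True assms(1) by (auto simp: sep_witness_def finite_subset)
qed (simp add: sep_witness_def)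

lemma card_l_coset:
  assumes "g \<in> carrier G" "X \<subseteq> carrier G"
  shows "card (g <# X) = card X"
proof -
  have "g <# X = (\<lambda>x. g \<otimes> x) ` X"
    by (auto simp: l_coset_def)
  moreover have "inj_on (\<lambda>x. g \<otimes> x) X"
    using inj_on_subset[OF inj_on_cmult[OF assms(1)] assms(2)] .
  ultimately show ?thesis
    by (simp add: card_image)
qed

lemma set_mult_comm:
  assumes "X \<subseteq> carrier G" "Y \<subseteq> carrier G"
  shows "X <#> Y = Y <#> X"
proof -
  have "X' <#> Y' \<subseteq> Y' <#> X'" if sub: "X' \<subseteq> carrier G" "Y' \<subseteq> carrier G" for X' Y'
  proof
    fix z assume "z \<in> X' <#> Y'"
    then obtain x y where xy: "x \<in> X'" "y \<in> Y'" "z = x \<otimes> y"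
      by (auto simp: set_mult_def)
    then have "z = y \<otimes> x"
      using sub m_comm by (meson subsetD)
    then show "z \<in> Y' <#> X'"
      using xy by (auto simp: set_mult_def)
  qed
  then show ?thesis
    using assms by blast
qed

lemma l_coset_set_mult:
  assumes "g \<in> carrier G" "X \<subseteq> carrier G" "B \<subseteq> carrier G"
  shows "(g <# X) <#> B = g <# (X <#> B)"
  using assms by (simp add: l_coset_eq_set_mult set_mult_assoc)

lemma atom_l_coset:
  assumes fin: "finite (carrier G)" and B: "B \<subseteq> carrier G"
    and g: "g \<in> carrier G" and at: "atom G k B X"
  shows "atom G k B (g <# X)"
proof -
  have X: "X \<subseteq> carrier G"
    using at by (simp add: atom_def fragment_def sep_witness_def)
  have "card ((g <# X) <#> B) = card (X <#> B)"
    using l_coset_set_mult[OF g X B] card_l_coset[OF g set_mult_closed[OF X B]] by simp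
  then show ?thesis
    using at card_l_coset[OF g X] l_coset_subset_G[OF X g]
    by (simp add: atom_def fragment_def sep_witness_iff[OF fin B])
qed

text \<open>Duality: the inverses \<open>Y\<close> of the complement \<open>C\<close> of
  \<open>X <#> B\<close> form a fragment of size \<open>card C\<close>, and an atom is a smallest
  fragment. The set \<open>Y <#> B\<close> misses the inverses of \<open>X\<close>, because
  \<open>inv x = inv c \<otimes> b\<close> would put \<open>c\<close> into
  \<open>X <#> B\<close>.\<close>

lemma atom_le_complement:
  assumes fin: "finite (carrier G)" and B: "B \<subseteq> carrier G" and at: "atom G k B X"
  shows "card X \<le> card (carrier G - (X <#> B))"
proof -
  define C where "C = carrier G - (X <#> B)"
  define Y where "Y = m_inv G ` C"
  have wit: "sep_witness G k B X"
    and kap: "kappa G k B = int (card (X <#> B)) - int (card X)"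
    using at by (auto simp: atom_def fragment_def)
  have X: "X \<subseteq> carrier G" and kX: "k \<le> card X" and kC: "card (X <#> B) + k \<le> card (carrier G)"
    using wit by (auto simp: sep_witness_iff[OF fin B])
  have C: "C \<subseteq> carrier G" and Y: "Y \<subseteq> carrier G"
    by (auto simp: C_def Y_def)
  have cC: "card C = card (carrier G) - card (X <#> B)"
    unfolding C_def using set_mult_closed[OF X B] fin by (meson card_Diff_subset finite_subset)
  have cY: "card Y = card C"
    unfolding Y_def using C inv_inj by (meson card_image inj_on_subset)
  have cX: "card (m_inv G ` X) = card X"
    using X inv_inj by (meson card_image inj_on_subset)
  have "(Y <#> B) \<inter> m_inv G ` X = {}"
  proof (rule ccontr)
    assume "\<not> ?thesis"
    then obtain c b x where c: "c \<in> C" "b \<in> B" "x \<in> X" "inv x = inv c \<otimes> b"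
      by (auto simp: set_mult_def Y_def)
    moreover have "c \<in> carrier G" "b \<in> carrier G" "x \<in> carrier G"
      using c B C X by auto
    ultimately have "c = x \<otimes> b"
      by (metis inv_closed inv_inv inv_solve_left m_comm m_closed)
    then show False
      using c by (auto simp: C_def set_mult_def)
  qed
  moreover have "m_inv G ` X \<subseteq> carrier G" "Y <#> B \<subseteq> carrier G"
    using X set_mult_closed[OF Y B] by auto
  ultimately have le: "card (Y <#> B) + card X \<le> card (carrier G)"
    using fin cX by (metis card_Un_disjoint card_mono finite_subset le_sup_iff)
  have witY: "sep_witness G k B Y"
    using Y le kX kC cC cY by (simp add: sep_witness_iff[OF fin B])
  \<comment> \<open>By \<open>le\<close> and \<open>cC\<close>,
    \<open>card (Y <#> B) - card Y\<close> is at most \<open>card (X <#> B) - card X\<close>, the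
    value of \<open>kappa\<close>; the reverse inequality is \<open>kappa_le\<close>.\<close>
  have "fragment G k B Y"
    using kappa_le[OF fin witY] witY kap le cC cY kC by (auto simp: fragment_def)
  then show ?thesis
    using at cY by (metis atom_def C_def)
qed

text \<open>The map sending \<open>Z\<close> to \<open>card (Z <#> B) - card Z\<close> is
  submodular. An intersection of size at least \<open>k\<close> would be a witness smaller than an
  atom, so its value would exceed \<open>kappa\<close>; the union would then be a witness with value
  below \<open>kappa\<close>.\<close>

lemma card_atom_Int_less:
  assumes fin: "finite (carrier G)" and B: "B \<subseteq> carrier G"
    and X: "atom G k B X" and Y: "atom G k B Y" and ne: "X \<noteq> Y"
  shows "card (X \<inter> Y) < k"
proof (rule ccontr)
  assume "\<not> card (X \<inter> Y) < k"
  then have kI: "k \<le> card (X \<inter> Y)" by simp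
  have Xc: "X \<subseteq> carrier G" and Yc: "Y \<subseteq> carrier G"
    and XB: "card (X <#> B) + k \<le> card (carrier G)"
    and kX: "kappa G k B = int (card (X <#> B)) - int (card X)"
    and kY: "kappa G k B = int (card (Y <#> B)) - int (card Y)"
    and kleX: "k \<le> card X"
    using X Y by (auto simp: atom_def fragment_def sep_witness_iff[OF fin B])
  have cXY: "card X = card Y"
    using X Y by (auto simp: atom_def intro: antisym)
  have fX: "finite X" "finite Y"
    using Xc Yc fin by (auto intro: finite_subset)
  have Ic: "X \<inter> Y \<subseteq> carrier G" and Uc: "X \<union> Y \<subseteq> carrier G"
    using Xc Yc by auto
  have fXB: "finite (X <#> B)" "finite (Y <#> B)"
    using set_mult_closed[OF Xc B] set_mult_closed[OF Yc B] fin by (auto intro: finite_subset)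
  have I_sub: "(X \<inter> Y) <#> B \<subseteq> (X <#> B) \<inter> (Y <#> B)"
    by (auto simp: set_mult_def)
  have U_eq: "(X \<union> Y) <#> B = (X <#> B) \<union> (Y <#> B)"
    by (auto simp: set_mult_def)
  have I_le: "card ((X \<inter> Y) <#> B) \<le> card ((X <#> B) \<inter> (Y <#> B))"
    using I_sub fXB by (intro card_mono) auto
  have sub: "card ((X \<union> Y) <#> B) + card ((X \<inter> Y) <#> B) \<le> card (X <#> B) + card (Y <#> B)"
    using I_le card_Un_Int[OF fXB] U_eq by simp
  have cU: "card (X \<union> Y) + card (X \<inter> Y) = card X + card Y"
    using card_Un_Int[OF fX] by simp
  have "card ((X \<inter> Y) <#> B) \<le> card (X <#> B)"
    using I_sub fXB by (intro card_mono) auto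
  then have witI: "sep_witness G k B (X \<inter> Y)"
    using Ic kI XB by (simp add: sep_witness_iff[OF fin B])
  have "X \<inter> Y \<noteq> X"
    using ne cXY fX by (metis card_subset_eq inf.cobounded2)
  then have "card (X \<inter> Y) < card X"
    using fX by (intro psubset_card_mono) auto
  then have "\<not> fragment G k B (X \<inter> Y)"
    using X by (auto simp: atom_def not_le)
  then have I_gr: "kappa G k B < int (card ((X \<inter> Y) <#> B)) - int (card (X \<inter> Y))"
    using kappa_le[OF fin witI] witI by (auto simp: fragment_def)
  have "card (carrier G - (X <#> B)) = card (carrier G) - card (X <#> B)"
    using set_mult_closed[OF Xc B] fXB by (simp add: card_Diff_subset)
  \<comment> \<open>Duality is what leaves room for the union: with \<open>sub\<close> and
    \<open>I_gr\<close> it gives \<open>card ((X \<union> Y) <#> B) < card (X <#> B) + card X - card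
    (X \<inter> Y)\<close>, which is at most \<open>card (carrier G) - k\<close>.\<close>
  then have dual: "card X + card (X <#> B) \<le> card (carrier G)"
    using atom_le_complement[OF fin B X] XB by simp
  have "k \<le> card (X \<union> Y)"
    using kleX fX by (meson card_mono finite_UnI sup_ge1 order_trans)
  moreover have "card ((X \<union> Y) <#> B) + k \<le> card (carrier G)"
    using sub cU I_gr dual kI kX kY cXY by linarith
  ultimately have witU: "sep_witness G k B (X \<union> Y)"
    using Uc by (simp add: sep_witness_iff[OF fin B])
  show False
    using kappa_le[OF fin witU] sub cU I_gr kX kY by linarith
qed

section \<open>Unions of cosets\<close>

lemma set_stabilizer_eq: "set_stabilizer G X = {g \<in> carrier G. g <# X = X}"
  by (simp add: set_stabilizer_def stabilizer_def)

lemma subgroup_set_stabilizer: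
  assumes X: "X \<subseteq> carrier G"
  shows "subgroup (set_stabilizer G X) G"
proof (rule subgroupI)
  show "set_stabilizer G X \<noteq> {}"
    using lcos_mult_one[OF X] by (auto simp: set_stabilizer_eq)
  show "inv a \<in> set_stabilizer G X" if "a \<in> set_stabilizer G X" for a
    using that lcos_m_assoc[OF X, of "inv a" a] lcos_mult_one[OF X]
    by (auto simp: set_stabilizer_eq)
  show "a \<otimes> b \<in> set_stabilizer G X" if "a \<in> set_stabilizer G X" "b \<in> set_stabilizer G X" for a b
    using that lcos_m_assoc[OF X, of a b] by (auto simp: set_stabilizer_eq)
qed (auto simp: set_stabilizer_eq)

text \<open>Counts a subset of \<open>G Mod H\<close> through its preimage \<open>\<Union>P\<close>;
  distinct cosets are disjoint and equally large.\<close>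

lemma card_Union_rcosets:
  assumes fin: "finite (carrier G)" and H: "subgroup H G" and P: "P \<subseteq> rcosets H"
  shows "card (\<Union>P) = card H * card P"
proof (rule card_partition[symmetric])
  have sub: "\<Union>P \<subseteq> carrier G"
    using rcosets_part_G[OF H] P by blast
  then show "finite (\<Union>P)"
    using fin finite_subset by blast
  then show "finite P"
    by (rule finite_UnionD)
  show "card c = card H" if "c \<in> P" for c
    using that P card_rcosets_equal[OF _ subgroup.subset[OF H]] by auto
  show "c1 \<inter> c2 = {}" if "c1 \<in> P" "c2 \<in> P" "c1 \<noteq> c2" for c1 c2
    using that P rcos_disjoint[OF H] by (auto simp: pairwise_def disjnt_def)
qed

text \<open>Preimages respect products because multiplication in \<open>G Mod H\<close> is itself
  the set product of cosets.\<close>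

lemma Union_set_mult_FactGroup:
  "\<Union>(P <#>\<^bsub>G Mod H\<^esub> Q) = \<Union>P <#> \<Union>Q"
  by (auto simp: set_mult_def FactGroup_def)

lemma Union_coset_image: "\<Union>(coset_image G H X) = H <#> X"
  by (auto simp: coset_image_def set_mult_def r_coset_def)

lemma coset_image_subset:
  assumes "X \<subseteq> carrier G"
  shows "coset_image G H X \<subseteq> rcosets H"
  using assms by (auto simp: coset_image_def RCOSETS_def)

lemma set_stabilizer_mult:
  assumes X: "X \<subseteq> carrier G"
  shows "set_stabilizer G X <#> X = X"
proof
  show "set_stabilizer G X <#> X \<subseteq> X"
    by (auto simp: set_stabilizer_eq set_mult_def l_coset_def)
  have "\<one> \<in> set_stabilizer G X"
    by (rule subgroup.one_closed[OF subgroup_set_stabilizer[OF X]])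
  then show "X \<subseteq> set_stabilizer G X <#> X"
    using X by (force simp: set_mult_def)
qed

text \<open>A set absorbed by \<open>H\<close> is the disjoint union of the cosets in its
  image.\<close>

lemma periodic_card_dvd:
  assumes fin: "finite (carrier G)" and H: "subgroup H G"
    and S: "S \<subseteq> carrier G" and per: "H <#> S = S"
  shows "card H dvd card S"
  using card_Union_rcosets[OF fin H coset_image_subset[OF S]] per
  by (simp add: Union_coset_image)

lemma periodic_l_coset:
  assumes "subgroup H G" "g \<in> carrier G" "X \<subseteq> carrier G" "H <#> X = X"
  shows "H <#> (g <# X) = g <# X"
proof -
  have Hc: "H \<subseteq> carrier G"
    by (rule subgroup.subset[OF assms(1)])
  have "H <#> (g <# X) = (H <#> {g}) <#> X"
    using assms(2,3) Hc by (simp add: l_coset_eq_set_mult set_mult_assoc)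
  also have "\<dots> = {g} <#> (H <#> X)"
    using assms(2,3) Hc set_mult_comm[of H "{g}"] set_mult_assoc[of "{g}" H X] by simp
  finally show ?thesis
    using assms(4) by (simp add: l_coset_eq_set_mult)
qed

lemma periodic_Int:
  assumes H: "subgroup H G" and S: "S \<subseteq> carrier G" "H <#> S = S" "H <#> T = T"
  shows "H <#> (S \<inter> T) = S \<inter> T"
proof
  have "H <#> (S \<inter> T) \<subseteq> (H <#> S) \<inter> (H <#> T)"
    by (auto simp: set_mult_def)
  then show "H <#> (S \<inter> T) \<subseteq> S \<inter> T"
    using S by simp
  show "S \<inter> T \<subseteq> H <#> (S \<inter> T)"
    using subgroup.one_closed[OF H] S(1) by (force simp: set_mult_def)
qed

end

text \<open>The right-hand side is the largest multiple of \<open>h\<close> strictly below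
  \<open>k\<close>: if \<open>m = h * q < k\<close>, then \<open>q < k/h\<close>, so
  \<open>q + 1\<close> is at most the ceiling.\<close>

lemma multiple_less_ceiling:
  fixes h k m :: nat
  assumes "h > 0" "h dvd m" "m < k"
  shows "int m \<le> \<lceil>real k / real h\<rceil> * int h - int h"
proof -
  obtain q where q: "m = h * q"
    using assms(2) by blast
  have "real q < real k / real h"
    using assms(1,3) q by (simp add: field_simps flip: of_nat_mult)
  then have "int q + 1 \<le> \<lceil>real k / real h\<rceil>"
    by linarith
  then have "(int q + 1) * int h \<le> \<lceil>real k / real h\<rceil> * int h"
    by (intro mult_right_mono) auto
  then show ?thesis
    using q by (simp add: algebra_simps)
qed

text \<open>Since a ceiling exceeds its argument by less than 1, the left-hand side is an integer
  strictly below \<open>k\<close>.\<close>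

lemma ceiling_multiple_le:
  fixes h k :: nat
  assumes "h > 0"
  shows "\<lceil>real k / real h\<rceil> * int h - int h \<le> int k - 1"
proof -
  have "real_of_int \<lceil>real k / real h\<rceil> - 1 < real k / real h"
    by linarith
  then have "(real_of_int \<lceil>real k / real h\<rceil> - 1) * real h < real k"
    using assms by (simp add: field_simps)
  then have "real_of_int (\<lceil>real k / real h\<rceil> * int h - int h) < real_of_int (int k)"
    by (simp add: algebra_simps)
  then show ?thesis
    by linarith
qed

section \<open>The bound\<close>

theorem theorem2p9:
  fixes G :: "('a, 'b) monoid_scheme"
    and k :: nat and r :: int
    and B X H :: "'a set" and Xbar :: "'a set set"
  assumes "comm_group G" and "finite (carrier G)"
    and "k \<ge> 2"
    and "B \<subseteq> carrier G" and "B \<noteq> {}"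
    and "separable G k B"
    and "r = kappa G k B - int (card B)"
    and "generate G (B <#>\<^bsub>G\<^esub> (set_inv\<^bsub>G\<^esub> B)) = carrier G"
    and "atom G k B X" and "\<not> is_coset G X"
    and "H = set_stabilizer G X"
    and "Xbar = coset_image G H X"
  shows "separable (G Mod H) 2 Xbar
    \<and> alpha G k B = card X
    \<and> int (card X) \<le> \<lceil>real k / real (card H)\<rceil> * int (card H) - int (card H)
          + r + int (card H) * int (alpha (G Mod H) 2 Xbar)
    \<and> \<lceil>real k / real (card H)\<rceil> * int (card H) - int (card H)
          + r + int (card H) * int (alpha (G Mod H) 2 Xbar)
        \<le> int k - 1 + r + int (card H) * int (alpha (G Mod H) 2 Xbar)"
proof -
  interpret comm_group G by fact
  note fin = assms(2) and Bc = assms(4) and at = assms(9)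
  have Xc: "X \<subseteq> carrier G" and kX: "k \<le> card X"
    and XB: "card (X <#>\<^bsub>G\<^esub> B) + k \<le> card (carrier G)"
    and kap: "kappa G k B = int (card (X <#>\<^bsub>G\<^esub> B)) - int (card X)"
    using at by (auto simp: atom_def fragment_def sep_witness_iff[OF fin Bc])
  have H: "subgroup H G"
    using subgroup_set_stabilizer[OF Xc] assms(11) by simp
  have Hc: "H \<subseteq> carrier G"
    by (rule subgroup.subset[OF H])
  have HX: "H <#>\<^bsub>G\<^esub> X = X"
    using set_stabilizer_mult[OF Xc] assms(11) by simp
  have finX: "finite X"
    using fin Xc finite_subset by blast
  have hpos: "card H > 0"
    using subgroup.one_closed[OF H] fin Hc card_gt_0_iff finite_subset by blast
  define m where "m = \<lceil>real k / real (card H)\<rceil> * int (card H) - int (card H)"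

  \<comment> \<open>Intersections of the atom with its translates\<close>
  have less: "card (X \<inter> (g <#\<^bsub>G\<^esub> X)) < k" if "g \<in> carrier G" "g \<notin> H" for g
  proof -
    \<comment> \<open>Translates of atoms are atoms, and an element outside the stabilizer gives a
      different one.\<close>
    have "X \<noteq> g <#\<^bsub>G\<^esub> X"
      using that assms(11) by (auto simp: set_stabilizer_eq)
    then show ?thesis
      using card_atom_Int_less[OF fin Bc at atom_l_coset[OF fin Bc that(1) at]] by blast
  qed
  have dvd: "card H dvd card (X \<inter> (g <#\<^bsub>G\<^esub> X))" if "g \<in> carrier G" for g
    using periodic_card_dvd[OF fin H, of "X \<inter> (g <#\<^bsub>G\<^esub> X)"] Xc
      periodic_Int[OF H Xc HX periodic_l_coset[OF H that Xc HX]] by blast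

  \<comment> \<open>If \<open>k \<le> card H\<close>, an intersection size that is below
    \<open>k\<close> and divisible by \<open>card H\<close> is 0. For \<open>x\<close>,
    \<open>y\<close> in \<open>X\<close>, translating by \<open>y \<otimes> inv x\<close> gives a
    set that meets \<open>X\<close> in \<open>y\<close>, so this element lies in \<open>H\<close>
    and \<open>X\<close> is the coset of \<open>x\<close>.\<close>
  have hk: "card H < k"
  proof (rule ccontr)
    assume "\<not> card H < k"
    then have empty: "X \<inter> (g <#\<^bsub>G\<^esub> X) = {}" if "g \<in> carrier G" "g \<notin> H" for g
      using less[OF that] dvd[OF that(1)] finX
      by (metis card_eq_0_iff finite_Int gr0I leI le_less_trans nat_dvd_not_less not_less)
    obtain x where x: "x \<in> X"
      using kX assms(3) by fastforce
    then have xc: "x \<in> carrier G"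
      using Xc by blast
    have "X = H #>\<^bsub>G\<^esub> x"
    proof
      show "H #>\<^bsub>G\<^esub> x \<subseteq> X"
        using x HX by (auto simp: set_mult_def r_coset_def)
      show "X \<subseteq> H #>\<^bsub>G\<^esub> x"
      proof
        fix y assume y: "y \<in> X"
        then have yc: "y \<in> carrier G"
          using Xc by blast
        have yx: "y = (y \<otimes>\<^bsub>G\<^esub> inv\<^bsub>G\<^esub> x) \<otimes>\<^bsub>G\<^esub> x"
          using xc yc by (simp add: m_assoc)
        then have "y \<in> X \<inter> ((y \<otimes>\<^bsub>G\<^esub> inv\<^bsub>G\<^esub> x) <#\<^bsub>G\<^esub> X)"
          using x y by (auto simp: l_coset_def)
        then have "y \<otimes>\<^bsub>G\<^esub> inv\<^bsub>G\<^esub> x \<in> H"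
          using empty xc yc by (metis empty_iff inv_closed m_closed)
        then show "y \<in> H #>\<^bsub>G\<^esub> x"
          using yx by (auto simp: r_coset_def)
      qed
    qed
    then show False
      using assms(10) H xc by (auto simp: is_coset_def RCOSETS_def)
  qed

  \<comment> \<open>Separability in the quotient\<close>
  let ?Q = "G Mod H"
  have Qc: "carrier ?Q = rcosets\<^bsub>G\<^esub> H"
    by (simp add: FactGroup_def)
  have Qfin: "finite (carrier ?Q)"
    unfolding Qc using fin Hc by (auto simp: RCOSETS_def)
  interpret Q: comm_group ?Q
    by (rule abelian_FactGroup[OF H])
  \<comment> \<open>The roles are exchanged: the image of \<open>X\<close> becomes the fixed set and
    the image of \<open>B\<close> the witness.\<close>
  define Bbar where "Bbar = coset_image G H B"
  have Xbc: "Xbar \<subseteq> rcosets\<^bsub>G\<^esub> H" and Bbc: "Bbar \<subseteq> rcosets\<^bsub>G\<^esub> H"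
    using coset_image_subset Xc Bc assms(12) by (auto simp: Bbar_def)
  have UX: "\<Union>Xbar = X" and UB: "\<Union>Bbar = H <#>\<^bsub>G\<^esub> B"
    using assms(12) HX by (auto simp: Union_coset_image Bbar_def)
  have BXc: "Bbar <#>\<^bsub>?Q\<^esub> Xbar \<subseteq> rcosets\<^bsub>G\<^esub> H"
    using Q.set_mult_closed[of Bbar Xbar] Xbc Bbc Qc by simp
  \<comment> \<open>The factor \<open>H\<close> coming from the preimage of \<open>Bbar\<close> is
    absorbed by \<open>X\<close>.\<close>
  have "\<Union>(Bbar <#>\<^bsub>?Q\<^esub> Xbar) = X <#>\<^bsub>G\<^esub> B"
    unfolding Union_set_mult_FactGroup UX UB
    using set_mult_assoc[OF Bc Hc Xc] HX set_mult_comm[OF Hc Bc] set_mult_comm[OF Xc Bc] by simp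
  then have cBX: "card H * card (Bbar <#>\<^bsub>?Q\<^esub> Xbar) = card (X <#>\<^bsub>G\<^esub> B)"
    using card_Union_rcosets[OF fin H BXc] by simp
  have cG: "card (carrier G) = card H * card (carrier ?Q)"
    using card_Union_rcosets[OF fin H, of "rcosets\<^bsub>G\<^esub> H"] rcosets_part_G[OF H] Qc by simp
  have cB: "card B \<le> card H * card Bbar"
  proof -
    have "B \<subseteq> H <#>\<^bsub>G\<^esub> B"
      using subgroup.one_closed[OF H] Bc by (force simp: set_mult_def)
    then have "card B \<le> card (H <#>\<^bsub>G\<^esub> B)"
      using set_mult_closed[OF Hc Bc] fin by (meson card_mono finite_subset)
    then show ?thesis
      using card_Union_rcosets[OF fin H Bbc] UB by simp
  qed

  \<comment> \<open>If \<open>B\<close> lay in a single coset, its differences would lie in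
    \<open>H\<close>, forcing \<open>H\<close> to be all of \<open>G\<close>; but
    \<open>card H < k \<le> card (carrier G)\<close>.\<close>
  have B2: "2 \<le> card Bbar"
  proof (rule ccontr)
    assume "\<not> 2 \<le> card Bbar"
    then have "card Bbar \<le> Suc 0" by simp
    then have one: "H #>\<^bsub>G\<^esub> b = H #>\<^bsub>G\<^esub> c" if "b \<in> B" "c \<in> B" for b c
      using card_le_Suc0_iff_eq[of Bbar] that Bbc Qfin Qc finite_subset
      by (metis Bbar_def coset_image_def imageI)
    have "B <#>\<^bsub>G\<^esub> (set_inv\<^bsub>G\<^esub> B) \<subseteq> H"
    proof
      fix z assume "z \<in> B <#>\<^bsub>G\<^esub> (set_inv\<^bsub>G\<^esub> B)"
      then obtain b c where bc: "b \<in> B" "c \<in> B" "z = b \<otimes>\<^bsub>G\<^esub> inv\<^bsub>G\<^esub> c"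
        by (auto simp: set_mult_def SET_INV_def)
      then have "b \<in> H #>\<^bsub>G\<^esub> c"
        using one[OF bc(1,2)] rcos_self[OF _ H, of b] Bc by auto
      then show "z \<in> H"
        using bc Bc H Hc by (auto simp: r_coset_def m_assoc subset_iff)
    qed
    then have "carrier G \<subseteq> H"
      using assms(8) generate_subgroup_incl[OF _ H] by blast
    then show False
      using hk XB fin card_mono[of H "carrier G"] Hc finite_subset by fastforce
  qed

  \<comment> \<open>The complement of \<open>X <#> B\<close> has at least \<open>k > card H\<close>
    elements and consists of whole cosets, hence of at least two.\<close>
  have c2: "card (Bbar <#>\<^bsub>?Q\<^esub> Xbar) + 2 \<le> card (carrier ?Q)"
  proof -
    have "card H * (card (Bbar <#>\<^bsub>?Q\<^esub> Xbar) + 1) < card H * card (carrier ?Q)"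
      using XB hk cBX cG by simp
    then have "card (Bbar <#>\<^bsub>?Q\<^esub> Xbar) + 1 < card (carrier ?Q)"
      using nat_mult_less_cancel_disj by blast
    then show ?thesis
      by simp
  qed
  have wit: "sep_witness ?Q 2 Xbar Bbar"
    using Q.sep_witness_iff[OF Qfin] Xbc Bbc Qc B2 c2 by simp
  then have sep: "separable ?Q 2 Xbar"
    by (auto simp: separable_def)
  obtain A where A: "atom ?Q 2 Xbar A"
    using atom_exists[OF Qfin sep] by blast
  have al: "alpha ?Q 2 Xbar = card A"
    by (rule alpha_eq[OF A])
  have Ac: "A \<subseteq> rcosets\<^bsub>G\<^esub> H" and A2: "2 \<le> card A"
    and kA: "kappa ?Q 2 Xbar = int (card (A <#>\<^bsub>?Q\<^esub> Xbar)) - int (card A)"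
    using A Q.sep_witness_iff[OF Qfin] Xbc Qc by (auto simp: atom_def fragment_def)
  have AXc: "A <#>\<^bsub>?Q\<^esub> Xbar \<subseteq> rcosets\<^bsub>G\<^esub> H"
    using Q.set_mult_closed[of A Xbar] Xbc Ac Qc by simp
  \<comment> \<open>Minimality of \<open>kappa\<close> in the quotient is applied to
    \<open>Bbar\<close> and scaled by \<open>card H\<close>. Replacing
    \<open>card H * card Bbar\<close> by the possibly smaller \<open>card B\<close> then produces
    \<open>r\<close>.\<close>
  have "int (card H) * (int (card (A <#>\<^bsub>?Q\<^esub> Xbar)) - int (card A))
      \<le> int (card H) * (int (card (Bbar <#>\<^bsub>?Q\<^esub> Xbar)) - int (card Bbar))"
    using kappa_le[OF Qfin wit] kA by (intro mult_left_mono) auto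
  also have "\<dots> = int (card (X <#>\<^bsub>G\<^esub> B)) - int (card H * card Bbar)"
    using cBX by (simp add: right_diff_distrib flip: of_nat_mult)
  also have "\<dots> \<le> int (card X) + r"
    using cB kap assms(7) by (simp flip: of_nat_mult)
  finally have upper: "int (card H * card (A <#>\<^bsub>?Q\<^esub> Xbar)) \<le> int (card X) + r + int (card H) * int (card A)"
    by (simp add: right_diff_distrib)

  \<comment> \<open>Two translates of the atom over a 2-atom of the quotient\<close>
  have "finite A"
    using Ac Qfin Qc by (metis finite_subset)
  moreover have "\<not> card A \<le> Suc 0"
    using A2 by simp
  ultimately obtain P1 P2 where P: "P1 \<in> A" "P2 \<in> A" "P1 \<noteq> P2"
    using card_le_Suc0_iff_eq[of A] by blast
  have "\<exists>a\<in>carrier G. Q = H #>\<^bsub>G\<^esub> a" if "Q \<in> A" for Q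
    using Ac that by (auto simp: RCOSETS_def)
  then obtain a b where ab: "a \<in> carrier G" "b \<in> carrier G" "P1 = H #>\<^bsub>G\<^esub> a" "P2 = H #>\<^bsub>G\<^esub> b"
    using P(1,2) by metis
  \<comment> \<open>Chosen so that \<open>a \<otimes> ?g = b\<close>: translating \<open>X\<close>
    and its \<open>?g\<close>-translate by \<open>a\<close> gives the translates of \<open>X\<close>
    by \<open>a\<close> and by \<open>b\<close>. Distinctness of \<open>P1\<close> and
    \<open>P2\<close> keeps \<open>?g\<close> out of \<open>H\<close>.\<close>
  let ?g = "inv\<^bsub>G\<^esub> a \<otimes>\<^bsub>G\<^esub> b"
  have g: "?g \<in> carrier G"
    using ab by simp
  have gH: "?g \<notin> H"
  proof
    assume "?g \<in> H"
    moreover have "b = ?g \<otimes>\<^bsub>G\<^esub> a"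
      using ab(1,2) g m_comm[OF g ab(1)] by (simp add: m_assoc[symmetric])
    ultimately have "b \<in> H #>\<^bsub>G\<^esub> a"
      unfolding r_coset_def by blast
    then show False
      using P ab repr_independence[OF _ ab(1) H, of b] by simp
  qed
  have "card (X \<union> (?g <#\<^bsub>G\<^esub> X)) + card (X \<inter> (?g <#\<^bsub>G\<^esub> X)) = card X + card X"
    using card_Un_Int[of X "?g <#\<^bsub>G\<^esub> X"] card_l_coset[OF g Xc] finX l_coset_subset_G[OF Xc g] fin
    by (metis finite_subset)
  moreover have "int (card (X \<inter> (?g <#\<^bsub>G\<^esub> X))) \<le> m"
    unfolding m_def by (rule multiple_less_ceiling[OF hpos dvd[OF g] less[OF g gH]])
  moreover have "card (X \<union> (?g <#\<^bsub>G\<^esub> X)) \<le> card H * card (A <#>\<^bsub>?Q\<^esub> Xbar)"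
  proof -
    have UA: "\<Union>(A <#>\<^bsub>?Q\<^esub> Xbar) = \<Union>A <#>\<^bsub>G\<^esub> X"
      using UX by (simp add: Union_set_mult_FactGroup)
    have "a \<in> \<Union>A" "b \<in> \<Union>A"
      using P ab rcos_self[OF _ H] by auto
    moreover have "a <#\<^bsub>G\<^esub> (?g <#\<^bsub>G\<^esub> X) = b <#\<^bsub>G\<^esub> X"
      using lcos_m_assoc[OF Xc ab(1) g] ab by (simp add: m_assoc[symmetric])
    moreover have "a <#\<^bsub>G\<^esub> (X \<union> (?g <#\<^bsub>G\<^esub> X)) = (a <#\<^bsub>G\<^esub> X) \<union> (a <#\<^bsub>G\<^esub> (?g <#\<^bsub>G\<^esub> X))"
      by (auto simp: l_coset_def)
    \<comment> \<open>Both translates lie in the preimage of the product of \<open>A\<close> and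
      \<open>Xbar\<close>, which is \<open>\<Union>A <#> X\<close> and has \<open>a\<close> and
      \<open>b\<close> in its first factor.\<close>
    ultimately have "a <#\<^bsub>G\<^esub> (X \<union> (?g <#\<^bsub>G\<^esub> X)) \<subseteq> \<Union>(A <#>\<^bsub>?Q\<^esub> Xbar)"
      unfolding UA by (auto simp: l_coset_eq_set_mult set_mult_def)
    moreover have "finite (\<Union>(A <#>\<^bsub>?Q\<^esub> Xbar))"
      using Union_mono[OF AXc] rcosets_part_G[OF H] fin by (simp add: finite_subset)
    ultimately have "card (a <#\<^bsub>G\<^esub> (X \<union> (?g <#\<^bsub>G\<^esub> X))) \<le> card (\<Union>(A <#>\<^bsub>?Q\<^esub> Xbar))"
      by (intro card_mono)
    then show ?thesis
      using card_l_coset[OF ab(1), of "X \<union> (?g <#\<^bsub>G\<^esub> X)"] Xc l_coset_subset_G[OF Xc g]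
        card_Union_rcosets[OF fin H AXc] by simp
  qed
  \<comment> \<open>The preimage size is at least \<open>2 * card X - m\<close> and at most the
    bound in \<open>upper\<close>; one \<open>card X\<close> cancels.\<close>
  ultimately have main: "int (card X) \<le> m + r + int (card H) * int (card A)"
    using upper by linarith
  show ?thesis
    using sep alpha_eq[OF at] main ceiling_multiple_le[OF hpos, of k] by (simp add: al m_def)
qed

end
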